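(* Let $\mathcal{T}\in\mathbb{R}^{n_1\times n_2\times n_3}$ satisfy $\mathcal{T}=(U_1^{\#},U_2^{\#},U_3^{\#}).\mathcal{G}^{\#}$ where $U_i^{\#}\in\mathbb{R}^{n_i\times r_i}_+$ with $(U_i^{\#})^\top e=e$ for $i\in\{1,2,3\}$ and $\mathcal{G}^{\#}\in\mathbb{R}^{r_1\times r_2\times r_3}$. Assume that $r_3\le r=r_1=r_2$, that $U_i^{\#}$ satisfies the SSC for $i\in\{1,2,3\}$, and that $i_2\in\{1,\dots,n_2\}$ and $i_3\in\{1,\dots,n_3\}$ are such that $\operatorname{rank}(\mathcal{T}^{(3)}_{i_3})=r$ and $\operatorname{rank}(\mathcal{T}^{(2)}_{i_2})=r_3$. Let $(U_1^*,U_2^*,U_3^*,\mathcal{G}^* )$ be any output of the following procedure: 1. Let $(U_1^*,U_2^*,S_{i_3}^* )$ be an optimal solution of $$\min_{U_1\in\mathbb{R}^{n_1\times r},\,U_2\in\mathbb{R}^{n_2\times r},\,S_{i_3}\in\mathbb{R}^{r\times r}}|\det(S_{i_3})|\ \text{ such that }\ \mathcal{T}^{(3)}_{i_3}=U_1S_{i_3}U_2^\top,\ U_i^\top e=e,\ U_i\ge0\text{ for }i\in\{1,2\}.$$ 2. Let $T_{i_2}^*=(U_1^* )^\dagger\mathcal{T}^{(2)}_{i_2}$ and let $(U_3^*,S_{i_2}^* )$ be an optimal solution of $$\min_{U_3\in\mathbb{R}^{n_3\times r_3},\,S_{i_2}\in\mathbb{R}^{r\times r_3}}\det(S_{i_2}^\top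 S_{i_2})\ \text{ such that }\ T_{i_2}^*=S_{i_2}U_3^\top,\ U_3^\top e=e,\ U_3\ge0.$$ 3. Let $\mathcal{G}^*=((U_1^* )^\dagger,(U_2^* )^\dagger,(U_3^* )^\dagger).\mathcal{T}$. Then there exist permutation matrices $\Pi_1,\Pi_2,\Pi_3$ such that $U_i^*=U_i^{\#}\Pi_i$ for all $i\in\{1,2,3\}$ and $\mathcal{G}^*=(\Pi_1^\top,\Pi_2^\top,\Pi_3^\top).\mathcal{G}^{\#}$.
   Context: $e$ is the all-ones vector of appropriate dimension, $e_k$ the $k$-th standard basis vector, $\ge$ is entrywise, and $U^\dagger$ denotes the Moore-Penrose inverse. For matrices $U_i\in\mathbb{R}^{n_i\times r_i}$ and $\mathcal{G}\in\mathbb{R}^{r_1\times r_2\times r_3}$, the tensor $(U_1,U_2,U_3).\mathcal{G}\in\mathbb{R}^{n_1\times n_2\times n_3}$ has entries $\sum_{i_1,i_2,i_3}(U_1)_{j_1,i_1}(U_2)_{j_2,i_2}(U_3)_{j_3,i_3}\mathcal{G}_{i_1,i_2,i_3}$. Slices of $\mathcal{T}\in\mathbb{R}^{n_1\times n_2\times n_3}$: along the third mode, $\mathcal{T}^{(3)}_k\in\mathbb{R}^{n_1\times n_2}$ with $(\mathcal{T}^{(3)}_k)_{i,j}=\mathcal{T}_{i,j,k}$; along the second mode, $\mathcal{T}^{(2)}_j\in\mathbb{R}^{n_1\times n_3}$ with $(\mathcal{T}^{(2)}_j)_{i,k}=\mathcal{T}_{i,j,k}$. For $A\in\mathbb{R}^{m\times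 n}$, $\operatorname{cone}(A)=\{Ay : y\in\mathbb{R}^n, y\ge 0\}$ and $\operatorname{cone}^*(A)=\{y\in\mathbb{R}^m : A^\top y\ge 0\}$. A matrix $H\in\mathbb{R}^{n\times r}_+$ with $r\ge2$ satisfies the sufficiently scattered condition (SSC) if: (SSC1) $\{x\in\mathbb{R}^r_+ : e^\top x\ge\sqrt{r-1}\,\|x\|_2\}\subseteq\operatorname{cone}(H^\top)$; and (SSC2) $\operatorname{cone}^*(H^\top)\cap\operatorname{bd}(\mathcal{C}^* )=\{\lambda e_k : \lambda\ge0,\ k\in\{1,\dots,r\}\}$, where $\mathcal{C}^*=\{x\in\mathbb{R}^r : e^\top x\ge\|x\|_2\}$ and $\operatorname{bd}$ denotes the boundary. *)

theory Defs
  imports "HOL-Analysis.Analysis"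
begin

text \<open>
  An \<open>m \<times> n\<close> matrix has type \<^typ>\<open>real^'n^'m\<close>, and an \<open>n1 \<times> n2 \<times> n3\<close> tensor has type
  \<^typ>\<open>real^'n3^'n2^'n1\<close>, so that \<open>T $ i $ j $ k\<close> is its \<open>(i, j, k)\<close> entry.  The library order on
  \<^typ>\<open>'a^'n\<close> is entrywise at every level, so \<open>0 \<le> U\<close> means that \<open>U\<close> is an entrywise nonnegative
  matrix.  The all-ones vector is \<open>vec 1\<close>, the standard basis vector is \<open>axis k 1\<close>,
  and \<open>norm\<close> is the Euclidean norm.
\<close>

definition nonneg_cone :: "real^'n^'m \<Rightarrow> (real^'m) set"
  where "nonneg_cone A = {A *v y | y. 0 \<le> y}"

definition dual_cone :: "real^'n^'m \<Rightarrow> (real^'m) set"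
  where "dual_cone A = {y. 0 \<le> transpose A *v y}"

text \<open>The cone \<open>C\<^sup>*\<close> whose boundary appears in (SSC2) below.\<close>

definition ones_cone :: "(real^'r) set"
  where "ones_cone = {x. norm x \<le> vec 1 \<bullet> x}"

text \<open>
  The condition is only meaningful for an entrywise nonnegative matrix with at least two columns;
  both requirements are part of the definition.  The last two conjuncts are (SSC1) and (SSC2).
\<close>

definition sufficiently_scattered :: "real^'r^'n \<Rightarrow> bool"
  where "sufficiently_scattered H \<longleftrightarrow>
    2 \<le> CARD('r) \<and> 0 \<le> H \<and>
    {x. 0 \<le> x \<and> sqrt (real CARD('r) - 1) * norm x \<le> vec 1 \<bullet> x} \<subseteq> nonneg_cone (transpose H) \<and>
    dual_cone (transpose H) \<inter> frontier ones_cone = {l *\<^sub>R axis k 1 | l k. 0 \<le> l}"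

definition permutation_matrix :: "real^'n^'n \<Rightarrow> bool"
  where "permutation_matrix P \<longleftrightarrow> (\<exists>p. p permutes UNIV \<and> P = (\<chi> i j. if i = p j then 1 else 0))"

definition multilinear_mult ::
    "real^'r1^'n1 \<Rightarrow> real^'r2^'n2 \<Rightarrow> real^'r3^'n3 \<Rightarrow> real^'r3^'r2^'r1 \<Rightarrow> real^'n3^'n2^'n1"
  where "multilinear_mult U1 U2 U3 G =
    (\<chi> j1 j2 j3. \<Sum>i1\<in>UNIV. \<Sum>i2\<in>UNIV. \<Sum>i3\<in>UNIV.
       U1 $ j1 $ i1 * U2 $ j2 $ i2 * U3 $ j3 $ i3 * G $ i1 $ i2 $ i3)"

definition slice2 :: "real^'n3^'n2^'n1 \<Rightarrow> 'n2 \<Rightarrow> real^'n3^'n1"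
  where "slice2 T j = (\<chi> i k. T $ i $ j $ k)"

definition slice3 :: "real^'n3^'n2^'n1 \<Rightarrow> 'n3 \<Rightarrow> real^'n2^'n1"
  where "slice3 T k = (\<chi> i j. T $ i $ j $ k)"

text \<open>The Moore-Penrose inverse is the unique solution of the four Penrose equations.\<close>

definition penrose :: "real^'n^'m \<Rightarrow> real^'m^'n \<Rightarrow> bool"
  where "penrose A X \<longleftrightarrow>
    A ** X ** A = A \<and> X ** A ** X = X \<and>
    transpose (A ** X) = A ** X \<and> transpose (X ** A) = X ** A"

definition pinv :: "real^'n^'m \<Rightarrow> real^'m^'n"
  where "pinv A = (THE X. penrose A X)"

lemma penrose_unique:
  assumes X: "penrose A X" and Y: "penrose A Y"
  shows "X = Y"
proof -
  have AXAY: "A ** X = A ** Y"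
  proof -
    have "A ** X = (A ** Y) ** (A ** X)"
      using Y by (simp add: penrose_def matrix_mul_assoc)
    also have "\<dots> = transpose ((A ** X) ** (A ** Y))"
      using X Y by (simp add: penrose_def matrix_transpose_mul)
    also have "(A ** X) ** (A ** Y) = A ** Y"
      using X by (simp add: penrose_def matrix_mul_assoc)
    finally show ?thesis using Y by (simp add: penrose_def)
  qed
  have XAYA: "X ** A = Y ** A"
  proof -
    have "X ** A = (X ** A) ** (Y ** A)"
      using Y by (metis penrose_def matrix_mul_assoc)
    also have "\<dots> = transpose ((Y ** A) ** (X ** A))"
      using X Y by (simp add: penrose_def matrix_transpose_mul)
    also have "(Y ** A) ** (X ** A) = Y ** A"
      using X by (metis penrose_def matrix_mul_assoc)
    finally show ?thesis using Y by (simp add: penrose_def)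
  qed
  have "X = X ** (A ** X)" using X by (simp add: penrose_def matrix_mul_assoc)
  also have "\<dots> = (X ** A) ** Y" by (simp add: AXAY matrix_mul_assoc)
  also have "\<dots> = Y" using Y by (simp add: XAYA penrose_def)
  finally show ?thesis .
qed

lemma generalized_inverse_exists: "\<exists>G. M ** G ** M = (M :: real^'n^'m)"
proof -
  have "\<exists>g. g ` UNIV \<subseteq> UNIV \<and> linear g \<and> (\<forall>v\<in>((*v) M) ` UNIV. M *v g v = v)"
    by (rule linear_exists_right_inverse_on[OF matrix_vector_mul_linear subspace_UNIV])
  then obtain g :: "real^'m \<Rightarrow> real^'n"
    where g: "linear g" "\<forall>x. M *v g (M *v x) = M *v x"
    by blast
  have "M ** matrix g ** M = M"
    using g by (simp add: matrix_eq matrix_works flip: matrix_vector_mul_assoc)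
  then show ?thesis ..
qed

lemma gram_cancel:
  fixes A :: "real^'n^'m" and B C :: "real^'k^'n"
  assumes "transpose A ** A ** B = transpose A ** A ** C"
  shows "A ** B = A ** C"
proof -
  have "A *v (B *v x) = A *v (C *v x)" for x
  proof -
    define z where "z = B *v x - C *v x"
    have "transpose A *v (A *v z) = 0"
      unfolding z_def matrix_vector_mult_diff_distrib
      by (simp only: matrix_vector_mul_assoc assms matrix_mul_assoc diff_self)
    then have "(A *v z) v* A = 0"
      by (simp only: transpose_matrix_vector)
    then have "(A *v z) \<bullet> (A *v z) = 0"
      by (metis dot_lmul_matrix inner_zero_left)
    then show ?thesis
      by (simp add: z_def matrix_vector_mult_diff_distrib)
  qed
  then show ?thesis by (simp add: matrix_eq flip: matrix_vector_mul_assoc)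
qed

lemma inverse13_exists:
  fixes A :: "real^'n^'m"
  shows "\<exists>X. A ** X ** A = A \<and> transpose (A ** X) = A ** X"
proof -
  obtain G where G: "(transpose A ** A) ** G ** (transpose A ** A) = transpose A ** A"
    using generalized_inverse_exists by blast
  define P where "P = A ** (G ** transpose A)"
  have "A ** (G ** (transpose A ** A)) = A ** mat 1"
    by (rule gram_cancel) (use G in \<open>simp add: matrix_mul_assoc\<close>)
  then have PA: "P ** A = A"
    by (simp add: P_def matrix_mul_assoc)
  have "transpose P = A ** (transpose G ** transpose A)"
    by (simp add: P_def matrix_transpose_mul matrix_mul_assoc)
  then have "P ** transpose P = transpose P"
    using PA by (simp add: matrix_mul_assoc)
  then have "transpose P = P"
    by (metis matrix_transpose_mul transpose_transpose)
  then show ?thesis using PA unfolding P_def by blast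
qed

lemma penrose_exists: "\<exists>X. penrose A X"
proof -
  obtain X where X: "A ** X ** A = A" "transpose (A ** X) = A ** X"
    using inverse13_exists by blast
  obtain Z where Z: "transpose A ** Z ** transpose A = transpose A"
    "transpose (transpose A ** Z) = transpose A ** Z"
    using inverse13_exists by blast
  define Y where "Y = transpose Z"
  have Y: "A ** Y ** A = A" "transpose (Y ** A) = Y ** A"
    using arg_cong[OF Z(1), of transpose] Z(2)
    by (simp_all add: Y_def matrix_transpose_mul matrix_mul_assoc)
  have 1: "A ** (Y ** A ** X) = A ** X" using Y by (simp add: matrix_mul_assoc)
  have 2: "(Y ** A ** X) ** A = Y ** A" using X by (metis matrix_mul_assoc)
  have "penrose A (Y ** A ** X)"
    unfolding penrose_def
  proof (intro conjI)
    show "A ** (Y ** A ** X) ** A = A" using X by (simp only: 1)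
    have "(Y ** A ** X) ** A ** (Y ** A ** X) = Y ** (A ** (Y ** A ** X))"
      by (simp only: 2) (simp only: matrix_mul_assoc)
    then show "(Y ** A ** X) ** A ** (Y ** A ** X) = Y ** A ** X"
      by (simp only: 1) (simp only: matrix_mul_assoc)
    show "transpose (A ** (Y ** A ** X)) = A ** (Y ** A ** X)" using X by (simp only: 1)
    show "transpose ((Y ** A ** X) ** A) = (Y ** A ** X) ** A" using Y by (simp only: 2)
  qed
  then show ?thesis ..
qed

lemma penrose_pinv: "penrose A (pinv A)"
  unfolding pinv_def using penrose_exists penrose_unique by (metis theI)


definition step1_feasible :: "real^'n2^'n1 \<Rightarrow> (real^'r^'n1) \<times> (real^'r^'n2) \<times> (real^'r^'r) \<Rightarrow> bool"
  where "step1_feasible M = (\<lambda>(U1, U2, S).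
    M = U1 ** S ** transpose U2 \<and>
    transpose U1 *v vec 1 = vec 1 \<and> transpose U2 *v vec 1 = vec 1 \<and> 0 \<le> U1 \<and> 0 \<le> U2)"

definition step1_optimal :: "real^'n2^'n1 \<Rightarrow> (real^'r^'n1) \<times> (real^'r^'n2) \<times> (real^'r^'r) \<Rightarrow> bool"
  where "step1_optimal M = is_arg_min (\<lambda>(U1, U2, S). \<bar>det S\<bar>) (step1_feasible M)"

definition step2_feasible :: "real^'n3^'r \<Rightarrow> (real^'r3^'n3) \<times> (real^'r3^'r) \<Rightarrow> bool"
  where "step2_feasible M = (\<lambda>(U3, S).
    M = S ** transpose U3 \<and> transpose U3 *v vec 1 = vec 1 \<and> 0 \<le> U3)"

definition step2_optimal :: "real^'n3^'r \<Rightarrow> (real^'r3^'n3) \<times> (real^'r3^'r) \<Rightarrow> bool"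
  where "step2_optimal M = is_arg_min (\<lambda>(U3, S). det (transpose S ** S)) (step2_feasible M)"

definition procedure_output ::
    "real^'n3^'n2^'n1 \<Rightarrow> 'n2 \<Rightarrow> 'n3 \<Rightarrow>
     real^'r^'n1 \<Rightarrow> real^'r^'n2 \<Rightarrow> real^'r3^'n3 \<Rightarrow> real^'r3^'r^'r \<Rightarrow> bool"
  where "procedure_output T i2 i3 U1 U2 U3 G \<longleftrightarrow>
    (\<exists>S. step1_optimal (slice3 T i3) (U1, U2, S)) \<and>
    (\<exists>S. step2_optimal (pinv U1 ** slice2 T i2) (U3, S)) \<and>
    G = multilinear_mult (pinv U1) (pinv U2) (pinv U3) T"

end

theory Submission
  imports Defs
begin

text \<open>
  If \<open>U\<close> is sufficiently scattered with unit column sums and \<open>U A\<close> is another nonnegative factor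
  with unit column sums, then every column \<open>a\<close> of \<open>A\<close> satisfies \<open>U a \<ge> 0\<close>.  Dualising (SSC1) gives
  \<open>\<parallel>a\<parallel> \<le> e\<^sup>T a = 1\<close>, so \<open>\<bar>det A\<bar> \<le> 1\<close> by Hadamard's inequality; if \<open>\<bar>det A\<bar> = 1\<close>, all columns have
  norm 1, hence lie on the boundary of \<open>C\<^sup>*\<close>, and (SSC2) makes them standard basis vectors.
  Two full-rank factorizations of one slice differ by such a change of basis on each side, and the
  minimised determinant of any feasible point is that of the ground truth divided by \<open>\<bar>det A\<bar> \<bar>det B\<bar>\<close>
  in the first step and by \<open>(det A)\<^sup>2\<close> in the second.  Optimality therefore forces these determinants
  to have absolute value 1.
\<close>

section \<open>Hadamard's inequality and its equality case for columns of norm at most 1\<close>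

lemma orthogonalize_rows:
  fixes A :: "real^'n^'n"
  shows "\<exists>B. det B = det A \<and> (\<forall>i. norm (row i B) \<le> norm (row i A)) \<and>
    (\<forall>i\<in>I. \<forall>j. j \<noteq> i \<longrightarrow> row i B \<bullet> row j B = 0)"
proof (induction rule: finite_induct[OF finite, of _ I])
  \<comment> \<open>Replacing a row by its component orthogonal to the span of the others preserves the determinant
     and does not destroy orthogonalities achieved earlier.\<close>
  case 1
  show ?case by auto
next
  case (2 k I)
  then obtain B where B: "det B = det A" "\<And>i. norm (row i B) \<le> norm (row i A)"
    "\<And>i j. i \<in> I \<Longrightarrow> j \<noteq> i \<Longrightarrow> row i B \<bullet> row j B = 0"
    by blast
  define S where "S = {row j B | j. j \<noteq> k}"
  obtain y z where y: "y \<in> span S" and z: "\<And>w. w \<in> span S \<Longrightarrow> orthogonal z w"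
    and yz: "row k B = y + z"
    using orthogonal_subspace_decomp_exists[of S "row k B"] by blast
  define C where "C = (\<chi> i. if i = k then row k B + (- y) else row i B)"
  have rC: "row i C = (if i = k then z else row i B)" for i
    using yz unfolding C_def row_def by (simp add: vec_lambda_unique)
  have "det C = det A"
    unfolding C_def using B(1) y
    by (subst det_row_span) (auto simp: S_def span_vec_eq intro: span_neg)
  moreover have "norm (row i C) \<le> norm (row i A)" for i
  proof (cases "i = k")
    case True
    have "norm z ^ 2 \<le> norm (row k B) ^ 2"
      using z[OF y] by (simp add: yz norm_add_Pythagorean orthogonal_commute)
    then show ?thesis using True B(2)[of k] rC by (simp add: power2_le_iff_abs_le)
  qed (simp add: rC B)
  moreover have "row i C \<bullet> row j C = 0" if "i \<in> insert k I" "j \<noteq> i" for i j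
  proof -
    have z0: "z \<bullet> row l B = 0" if "l \<noteq> k" for l
      using z[of "row l B"] that by (auto simp: S_def orthogonal_def intro!: span_base)
    show ?thesis
      using that z0[of i] z0[of j] B(3)[of i j] by (auto simp: rC inner_commute)
  qed
  ultimately show ?case by blast
qed

text \<open>Once all rows are orthogonal, \<open>B ** transpose B\<close> is diagonal with the
  squared row norms on it, so \<open>(det B)\<^sup>2\<close> is their product; orthogonalizing kept
  the determinant and lengthened no row.\<close>

theorem hadamard_inequality:
  fixes A :: "real^'n^'n"
  shows "\<bar>det A\<bar> \<le> (\<Prod>i\<in>UNIV. norm (row i A))"
proof -
  obtain B where B: "det B = det A" "\<And>i. norm (row i B) \<le> norm (row i A)"
    "\<And>i j. j \<noteq> i \<Longrightarrow> row i B \<bullet> row j B = 0"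
    using orthogonalize_rows[of A UNIV] by blast
  have BB: "(B ** transpose B) $ i $ j = row i B \<bullet> row j B" for i j
    by (simp add: matrix_matrix_mult_def transpose_def row_def inner_vec_def)
  have "(det B)\<^sup>2 = det (B ** transpose B)"
    by (simp add: det_mul power2_eq_square)
  also have "\<dots> = (\<Prod>i\<in>UNIV. (B ** transpose B) $ i $ i)"
    by (rule det_diagonal) (use B(3) BB in auto)
  also have "\<dots> = (\<Prod>i\<in>UNIV. norm (row i B))\<^sup>2"
    by (simp add: BB power2_norm_eq_inner prod_power_distrib)
  finally have "\<bar>det B\<bar> = \<bar>\<Prod>i\<in>UNIV. norm (row i B)\<bar>"
    by (metis real_sqrt_abs)
  also have "\<dots> = (\<Prod>i\<in>UNIV. norm (row i B))"
    by (simp add: prod_nonneg)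
  also have "\<dots> \<le> (\<Prod>i\<in>UNIV. norm (row i A))"
    by (rule prod_mono) (simp add: B)
  finally show ?thesis by (simp add: B)
qed

lemma det_contraction_columns:
  fixes A :: "real^'n^'n"
  assumes "\<And>j. norm (column j A) \<le> 1"
  shows "\<bar>det A\<bar> \<le> 1"
    and "\<bar>det A\<bar> = 1 \<Longrightarrow> norm (column j A) = 1"
proof -
  have H: "\<bar>det A\<bar> \<le> (\<Prod>i\<in>UNIV. norm (column i A))"
    using hadamard_inequality[of "transpose A"] by (simp add: row_transpose)
  show "\<bar>det A\<bar> \<le> 1"
    using H prod_le_1[of UNIV "\<lambda>i. norm (column i A)"] assms by fastforce
  \<comment> \<open>Splitting off column \<open>j\<close> leaves a product of at most 1, so Hadamard
    bounds the determinant by the norm of column \<open>j\<close> alone.\<close>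
  have "(\<Prod>i\<in>UNIV - {j}. norm (column i A)) \<le> 1"
    by (rule prod_le_1) (use assms in auto)
  then have "(\<Prod>i\<in>UNIV. norm (column i A)) \<le> norm (column j A)"
    by (subst prod.remove[of _ j]) (auto intro: mult_left_le)
  then show "norm (column j A) = 1" if "\<bar>det A\<bar> = 1"
    using H that assms[of j] by linarith
qed

section \<open>Geometry of the cones in (SSC1) and (SSC2)\<close>

lemma inner_one_vec: "1 \<bullet> x = (\<Sum>i\<in>UNIV. x $ i)" for x :: "real^'n"
  by (simp add: inner_vec_def)

text \<open>On the hyperplane orthogonal to the ones vector, \<open>w $ i\<close> is the inner
  product of \<open>w\<close> with the projection \<open>v\<close> of \<open>axis i 1\<close>. Since
  \<open>v\<close> has squared norm \<open>1 - 1 / n\<close>, this is Cauchy-Schwarz.\<close>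

lemma abs_component_le_of_sum_zero:
  fixes w :: "real^'n"
  assumes "vec 1 \<bullet> w = 0"
  shows "real CARD('n) * (w $ i)\<^sup>2 \<le> (real CARD('n) - 1) * (norm w)\<^sup>2"
proof -
  define n where "n = real CARD('n)"
  have n: "n > 0" by (simp add: n_def)
  define v :: "real^'n" where "v = axis i 1 - (1 / n) *\<^sub>R vec 1"
  have ee: "(1 :: real^'n) \<bullet> 1 = n" by (simp add: inner_one_vec n_def)
  have ae: "(1 :: real^'n) \<bullet> axis i 1 = 1" "axis i 1 \<bullet> (1 :: real^'n) = 1"
    by (simp_all add: inner_axis inner_axis')
  have "v \<bullet> v = 1 - 1 / n"
    using n by (simp add: v_def inner_diff_left inner_diff_right ee ae inner_axis_axis)
  then have nv: "n * (norm v)\<^sup>2 = n - 1"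
    using n by (simp add: power2_norm_eq_inner field_simps)
  have "w $ i = v \<bullet> w"
    using assms by (simp add: v_def inner_diff_left inner_axis')
  then have "(w $ i)\<^sup>2 \<le> (norm v)\<^sup>2 * (norm w)\<^sup>2"
    using Cauchy_Schwarz_ineq[of v w] by (simp add: power2_norm_eq_inner)
  then have "n * (w $ i)\<^sup>2 \<le> n * ((norm v)\<^sup>2 * (norm w)\<^sup>2)"
    using n by simp
  also have "\<dots> = (n - 1) * (norm w)\<^sup>2"
    by (simp only: nv mult.assoc[symmetric])
  finally show ?thesis by (simp only: n_def)
qed

text \<open>Splitting \<open>y\<close> into a multiple of \<open>e\<close> and an orthogonal part
  \<open>w\<close>, with \<open>s = e \<bullet> y\<close>, turns the goal into
  \<open>0 \<le> s\<close> and \<open>r * (norm w)\<^sup>2 \<le> (r - 1) * s\<^sup>2\<close>. Both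
  follow by testing \<open>y\<close> against suitable vectors of the (SSC1) cone.\<close>

lemma dual_ice_cream_cone:
  fixes y :: "real^'r"
  assumes card: "2 \<le> CARD('r)"
    and y: "\<And>x. 0 \<le> x \<Longrightarrow> sqrt (real CARD('r) - 1) * norm x \<le> vec 1 \<bullet> x \<Longrightarrow> 0 \<le> y \<bullet> x"
  shows "y \<in> ones_cone"
proof -
  define r where "r = real CARD('r)"
  have r: "2 \<le> r" using card by (simp add: r_def)
  define e :: "real^'r" where "e = vec 1"
  have ee: "e \<bullet> e = r" by (simp add: e_def inner_one_vec r_def)
  define s where "s = e \<bullet> y"
  define w where "w = y - (s / r) *\<^sub>R e"
  have ew: "e \<bullet> w = 0" using r by (simp add: w_def inner_diff_right ee s_def)
  have yw: "y = (s / r) *\<^sub>R e + w" by (simp add: w_def)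
  have yy: "(norm y)\<^sup>2 = s\<^sup>2 / r + (norm w)\<^sup>2"
    unfolding power2_norm_eq_inner using r ew
    by (simp add: yw inner_add_left inner_add_right ee inner_commute[of w e] power2_eq_square)
  \<comment> \<open>The tight test vector is \<open>e - t w\<close> with \<open>t\<close> as large as the cone condition allows.\<close>
  have key: "0 \<le> s - t * (norm w)\<^sup>2" if t: "0 \<le> t" "(r - 1) * (t\<^sup>2 * (norm w)\<^sup>2) \<le> r" for t
  proof -
    define x where "x = e - t *\<^sub>R w"
    \<comment> \<open>The bound on \<open>t\<close> from the cone condition, together with the
      component bound for \<open>w\<close>, also keeps the test vector in the nonnegative
      orthant.\<close>
    have "t * w $ i \<le> 1" for i
    proof -
      have "r * (w $ i)\<^sup>2 \<le> (r - 1) * (norm w)\<^sup>2"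
        using abs_component_le_of_sum_zero[of w i] ew by (simp add: r_def e_def)
      then have "t\<^sup>2 * (r * (w $ i)\<^sup>2) \<le> t\<^sup>2 * ((r - 1) * (norm w)\<^sup>2)"
        by (intro mult_left_mono) auto
      also have "\<dots> \<le> r" using t by (simp add: algebra_simps)
      finally have "r * (t * w $ i)\<^sup>2 \<le> r * 1" by (simp add: power_mult_distrib algebra_simps)
      then have "(t * w $ i)\<^sup>2 \<le> 1" using r by (simp only: mult_le_cancel_left_pos)
      then show ?thesis by (simp add: abs_square_le_1)
    qed
    then have x0: "0 \<le> x" by (simp add: x_def e_def less_eq_vec_def)
    have ex: "e \<bullet> x = r" by (simp add: x_def inner_diff_right ee ew)
    have xx: "(norm x)\<^sup>2 = r + t\<^sup>2 * (norm w)\<^sup>2"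
      unfolding power2_norm_eq_inner
      by (simp add: x_def inner_diff_left inner_diff_right ee ew inner_commute[of w e] power2_eq_square)
    have "(r - 1) * (norm x)\<^sup>2 \<le> r\<^sup>2"
      unfolding xx using t(2) by (simp add: power2_eq_square algebra_simps)
    then have "(sqrt (r - 1) * norm x)\<^sup>2 \<le> r\<^sup>2"
      using r by (simp add: power_mult_distrib)
    then have "sqrt (r - 1) * norm x \<le> r"
      by (rule power2_le_imp_le) (use r in simp)
    then have "0 \<le> y \<bullet> x" using y[OF x0] ex by (simp add: r_def e_def)
    also have "y \<bullet> x = s - t * (norm w)\<^sup>2"
      unfolding power2_norm_eq_inner using r
      by (simp add: yw x_def inner_diff_right inner_add_left ee ew inner_commute[of w e])
    finally show ?thesis .
  qed
  have s0: "0 \<le> s" using key[of 0] r by simp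
  have "(r - 1) * s\<^sup>2 \<ge> r * (norm w)\<^sup>2"
  proof (cases "w = 0")
    case True
    then show ?thesis using r by simp
  next
    case False
    \<comment> \<open>This \<open>t\<close> gives equality in the cone condition; squaring
      \<open>t * (norm w)\<^sup>2 \<le> s\<close> then yields the claim.\<close>
    define t where "t = sqrt (r / ((r - 1) * (norm w)\<^sup>2))"
    have t2: "t\<^sup>2 = r / ((r - 1) * (norm w)\<^sup>2)" using r by (simp add: t_def)
    have t0: "0 \<le> t" using r by (simp add: t_def)
    have tr: "(r - 1) * (t\<^sup>2 * (norm w)\<^sup>2) = r" using False r by (simp add: t2)
    have "t * (norm w)\<^sup>2 \<le> s" using key[OF t0] tr by simp
    then have "(t * (norm w)\<^sup>2)\<^sup>2 \<le> s\<^sup>2" using t0 by (intro power_mono) auto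
    then have "(r - 1) * (t * (norm w)\<^sup>2)\<^sup>2 \<le> (r - 1) * s\<^sup>2" using r by (intro mult_left_mono) auto
    also have "(r - 1) * (t * (norm w)\<^sup>2)\<^sup>2 = ((r - 1) * (t\<^sup>2 * (norm w)\<^sup>2)) * (norm w)\<^sup>2"
      by (simp add: power2_eq_square)
    finally show ?thesis by (simp only: tr)
  qed
  then have "(norm y)\<^sup>2 \<le> s\<^sup>2"
    using r by (simp add: yy field_simps)
  then have "norm y \<le> s" using s0 by (rule power2_le_imp_le)
  then show ?thesis by (simp add: ones_cone_def s_def e_def)
qed

lemma inner_transpose_mult: "x \<bullet> (transpose A *v y) = (A *v x) \<bullet> y" for A :: "real^'n^'m"
  unfolding transpose_matrix_vector
  by (subst inner_commute, subst dot_lmul_matrix, rule inner_commute)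

lemma dual_cone_transpose: "y \<in> dual_cone (transpose H) \<longleftrightarrow> 0 \<le> H *v y"
  by (simp add: dual_cone_def)

text \<open>Dualizing reverses the inclusion in (SSC1): a vector \<open>x\<close> of the smaller
  cone is \<open>transpose H *v z\<close> with \<open>z\<close> nonnegative, so
  \<open>y \<bullet> x\<close> equals \<open>(H *v y) \<bullet> z\<close>, which is
  nonnegative.\<close>

lemma sufficiently_scattered_dual_cone_subset:
  fixes H :: "real^'r^'n"
  assumes "sufficiently_scattered H"
  shows "dual_cone (transpose H) \<subseteq> ones_cone"
proof
  fix y assume y: "y \<in> dual_cone (transpose H)"
  show "y \<in> ones_cone"
  proof (rule dual_ice_cream_cone)
    show "2 \<le> CARD('r)" using assms by (simp add: sufficiently_scattered_def)
    fix x :: "real^'r"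
    assume "0 \<le> x" "sqrt (real CARD('r) - 1) * norm x \<le> vec 1 \<bullet> x"
    then have "x \<in> nonneg_cone (transpose H)"
      using assms by (auto simp: sufficiently_scattered_def)
    then obtain z where z: "0 \<le> z" "x = transpose H *v z"
      by (auto simp: nonneg_cone_def)
    have "y \<bullet> x = (H *v y) \<bullet> z"
      unfolding z(2) by (rule inner_transpose_mult)
    also have "0 \<le> \<dots>"
      using z(1) y unfolding inner_vec_def
      by (intro sum_nonneg) (simp add: dual_cone_transpose less_eq_vec_def)
    finally show "0 \<le> y \<bullet> x" .
  qed
qed

lemma frontier_ones_coneI:
  fixes x :: "real^'r"
  assumes card: "2 \<le> CARD('r)" and x: "norm x = vec 1 \<bullet> x"
  shows "x \<in> frontier ones_cone"
proof -
  define r where "r = real CARD('r)"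
  have r: "2 \<le> r" using card by (simp add: r_def)
  have ne: "norm (1 :: real^'r) = sqrt r"
    by (simp add: norm_eq_sqrt_inner inner_one_vec r_def)
  \<comment> \<open>Strictness comes from \<open>r\<close> being at least 2; in dimension 1 the cone
    is a half-line whose interior points also satisfy the norm equation.\<close>
  have sr: "sqrt r < r" using r by (intro real_less_lsqrt) (simp_all add: power2_eq_square)
  have "x \<notin> interior ones_cone"
  proof
    assume "x \<in> interior ones_cone"
    then obtain \<epsilon> where \<epsilon>: "\<epsilon> > 0" "ball x \<epsilon> \<subseteq> ones_cone"
      by (auto simp: mem_interior)
    \<comment> \<open>Moving by \<open>- d e\<close> lowers \<open>e \<bullet> x\<close> by \<open>d r\<close> but the norm by at most \<open>d sqrt r\<close>.\<close>
    define d where "d = \<epsilon> / (2 * r)"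
    have d: "d > 0" using \<epsilon> r by (simp add: d_def)
    define y where "y = x - d *\<^sub>R (vec 1 :: real^'r)"
    have "dist x y = d * sqrt r" using d by (simp add: y_def dist_norm ne)
    also have "\<dots> < d * r" using sr d by simp
    also have "\<dots> < \<epsilon>" using \<epsilon> r by (simp add: d_def)
    finally have "norm y \<le> vec 1 \<bullet> y" using \<epsilon>(2) by (auto simp: ones_cone_def)
    also have "\<dots> = norm x - d * r" by (simp add: y_def inner_diff_right x inner_one_vec r_def)
    also have "\<dots> < norm x - d * sqrt r" using sr d by simp
    also have "\<dots> \<le> norm y" using norm_triangle_ineq2[of x "d *\<^sub>R (vec 1 :: real^'r)"] d by (simp add: y_def ne)
    finally show False by simp
  qed
  moreover have "x \<in> closure ones_cone"
    using x by (intro subsetD[OF closure_subset]) (simp add: ones_cone_def)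
  ultimately show ?thesis by (simp add: frontier_def)
qed

section \<open>Permutation matrices and changes of basis between scattered factors\<close>

lemma permutation_matrixI:
  fixes A :: "real^'n^'n"
  assumes "det A \<noteq> 0" and "\<And>j. column j A = axis (f j) 1"
  shows "permutation_matrix A"
proof -
  have A: "A = (\<chi> i j. if i = f j then 1 else 0)"
    using assms(2) by (simp add: vec_eq_iff column_def axis_def)
  \<comment> \<open>Two equal columns would make the determinant vanish.\<close>
  have "inj f"
  proof
    fix i j assume "f i = f j"
    then show "i = j"
      using det_identical_columns[of i j A] assms by metis
  qed
  then have "f permutes UNIV"
    by (intro bij_imp_permutes) (simp_all add: bij_def finite_UNIV_inj_surj)
  then show ?thesis using A by (auto simp: permutation_matrix_def)
qed

lemma permutation_matrix_mul_transpose: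
  assumes "permutation_matrix P"
  shows "P ** transpose P = mat 1"
proof -
  obtain p where p: "p permutes UNIV" "P = (\<chi> i j. if i = p j then 1 else 0)"
    using assms by (auto simp: permutation_matrix_def)
  have "(\<Sum>k\<in>UNIV. (if i = p k then 1 else 0) * (if j = p k then 1 else 0)) =
      (if i = j then 1 else (0::real))" for i j
  proof -
    have "i = p k \<longleftrightarrow> k = inv p i" for k
      using permutes_inv_eq[OF p(1)] by metis
    then have "(if i = p k then 1 else 0) * (if j = p k then 1 else 0) =
        (if k = inv p i then if i = j then 1 else 0 else (0::real))" for k
      by fastforce
    then show ?thesis by simp
  qed
  then show ?thesis
    by (simp add: p(2) vec_eq_iff matrix_matrix_mult_def transpose_def mat_def)
qed

lemma sufficiently_scattered_change_of_basis:
  fixes U :: "real^'r^'n" and A :: "real^'r^'r"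
  assumes ssc: "sufficiently_scattered U"
    and U: "transpose U *v vec 1 = vec 1"
    and V: "0 \<le> U ** A" "transpose (U ** A) *v vec 1 = vec 1"
  shows "\<bar>det A\<bar> \<le> 1" and "\<bar>det A\<bar> = 1 \<Longrightarrow> permutation_matrix A"
proof -
  have card: "2 \<le> CARD('r)" using ssc by (simp add: sufficiently_scattered_def)
  have dual: "column j A \<in> dual_cone (transpose U)" for j
  proof -
    have "U *v column j A = column j (U ** A)"
      by (simp add: vec_eq_iff matrix_vector_mult_def matrix_matrix_mult_def column_def)
    then show ?thesis
      using V(1) by (simp add: dual_cone_transpose column_def less_eq_vec_def)
  qed
  \<comment> \<open>The unit column sums of \<open>U\<close> cancel from those of
    \<open>U ** A\<close>, so every column of \<open>A\<close> sums to 1.\<close>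
  have "transpose A *v vec 1 = vec 1"
    using U V(2) by (simp add: matrix_transpose_mul flip: matrix_vector_mul_assoc)
  then have sum1: "vec 1 \<bullet> column j A = 1" for j
    by (simp add: vec_eq_iff matrix_vector_mult_def transpose_def inner_one_vec column_def)
  have le: "norm (column j A) \<le> 1" for j
    using sufficiently_scattered_dual_cone_subset[OF ssc] dual[of j] sum1[of j]
    by (auto simp: ones_cone_def)
  show "\<bar>det A\<bar> \<le> 1" by (rule det_contraction_columns(1)[OF le])
  assume det: "\<bar>det A\<bar> = 1"
  have "\<exists>k. column j A = axis k 1" for j
  proof -
    have "column j A \<in> frontier ones_cone"
      using det_contraction_columns(2)[OF le det] sum1 by (intro frontier_ones_coneI card) simp
    then obtain l k where lk: "column j A = l *\<^sub>R axis k 1"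
      using ssc dual[of j] unfolding sufficiently_scattered_def by blast
    then have "l = 1" using sum1[of j] by (simp add: inner_axis)
    then show ?thesis using lk by auto
  qed
  then obtain f where "\<And>j. column j A = axis (f j) 1" by metis
  then show "permutation_matrix A" using det by (intro permutation_matrixI) auto
qed

section \<open>Full-rank factorizations, Gram determinants and pseudoinverses\<close>

lemma full_column_rank_left_inverse:
  fixes A :: "real^'n^'m"
  assumes "CARD('n) \<le> rank A"
  obtains L where "L ** A = mat 1"
proof -
  have "rank A = CARD('n)" using assms rank_bound[of A] by simp
  then show ?thesis
    using that by (metis full_rank_injective matrix_left_invertible_injective)
qed

lemma det_pos_of_pos_def:
  fixes M :: "real^'n^'n"
  assumes M: "\<And>x. x \<noteq> 0 \<Longrightarrow> 0 < x \<bullet> (M *v x)"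
  shows "0 < det M"
proof (rule ccontr)
  assume "\<not> 0 < det M"
  \<comment> \<open>On the segment from the identity to \<open>M\<close> every matrix is positive definite, so the determinant
     cannot change sign.\<close>
  define N where "N t = (1 - t) *\<^sub>R mat 1 + t *\<^sub>R M" for t
  have "continuous_on {0..1} (\<lambda>t. det (N t))"
    unfolding det_def N_def by (auto simp: mat_def intro!: continuous_intros)
  moreover have "det (N 1) \<le> 0" "0 \<le> det (N 0)"
    using \<open>\<not> 0 < det M\<close> by (simp_all add: N_def)
  ultimately obtain t where t: "0 \<le> t" "t \<le> 1" "det (N t) = 0"
    using IVT2'[of "\<lambda>t. det (N t)" 1 0 0] by auto
  then obtain x where x: "x \<noteq> 0" "N t *v x = 0"
    by (metis invertible_det_nz invertible_left_inverse matrix_left_invertible_ker)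
  have "N t *v x = (1 - t) *\<^sub>R x + t *\<^sub>R (M *v x)"
    by (simp add: N_def matrix_vector_mult_add_rdistrib flip: scaleR_matrix_vector_assoc)
  then have "x \<bullet> (N t *v x) = (1 - t) * (x \<bullet> x) + t * (x \<bullet> (M *v x))"
    by (simp add: inner_add_right)
  moreover have "0 < (1 - t) * (x \<bullet> x) + t * (x \<bullet> (M *v x))"
  proof (cases "t = 0")
    case False
    then show ?thesis using M[OF x(1)] t by (intro add_nonneg_pos) auto
  qed (use x in simp)
  ultimately show False using x by simp
qed

lemma det_gram_pos:
  fixes A :: "real^'n^'m"
  assumes "L ** A = mat 1"
  shows "0 < det (transpose A ** A)"
proof (rule det_pos_of_pos_def)
  fix x :: "real^'n" assume "x \<noteq> 0"
  have "L *v (A *v x) = x" by (simp add: matrix_vector_mul_assoc assms)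
  then have "A *v x \<noteq> 0" using \<open>x \<noteq> 0\<close> by force
  moreover have "x \<bullet> ((transpose A ** A) *v x) = (A *v x) \<bullet> (A *v x)"
    by (simp only: inner_transpose_mult flip: matrix_vector_mul_assoc)
  ultimately show "0 < x \<bullet> ((transpose A ** A) *v x)" by simp
qed

text \<open>The product has rank equal to the inner dimension, so \<open>Y\<close> and
  \<open>U\<close> have left inverses \<open>L\<close> and \<open>M\<close>. Cancelling
  \<open>Y\<close> reads off the transition matrix as \<open>transpose (L ** X)\<close>; cancelling
  \<open>U\<close> then expresses \<open>X\<close> through \<open>Y\<close> with the same
  matrix.\<close>

lemma factorization_unique:
  fixes X Y :: "real^'k^'m" and U V :: "real^'k^'n"
  assumes eq: "X ** transpose U = Y ** transpose V"
    and rank: "rank (X ** transpose U) = CARD('k)"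
  obtains A where "V = U ** A" "X = Y ** transpose A"
proof -
  have "CARD('k) \<le> rank Y" using rank_mul_le_left[of Y "transpose V"] rank eq by simp
  then obtain L where L: "L ** Y = mat 1" by (rule full_column_rank_left_inverse)
  have "CARD('k) \<le> rank U" using rank_mul_le_right[of X "transpose U"] rank by (simp add: rank_transpose)
  then obtain M where M: "M ** U = mat 1" by (rule full_column_rank_left_inverse)
  define A where "A = transpose (L ** X)"
  have "transpose V = L ** (Y ** transpose V)" by (simp add: matrix_mul_assoc L)
  also have "\<dots> = transpose A ** transpose U" by (simp add: A_def matrix_mul_assoc flip: eq)
  finally have V: "V = U ** A" by (metis matrix_transpose_mul transpose_transpose)
  have "X = X ** transpose U ** transpose M"
    by (metis M matrix_mul_assoc matrix_mul_rid matrix_transpose_mul transpose_mat)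
  also have "\<dots> = Y ** transpose A ** transpose (M ** U)"
    by (simp add: eq V matrix_transpose_mul matrix_mul_assoc)
  finally have "X = Y ** transpose A" by (simp add: M)
  with V that show ?thesis by blast
qed

lemma pinv_left_inverse:
  assumes "L ** A = mat 1"
  shows "pinv A ** A = mat 1"
proof -
  have "A ** (pinv A ** A) = A" using penrose_pinv[of A] by (simp add: penrose_def matrix_mul_assoc)
  then have "L ** A ** (pinv A ** A) = L ** A" by (simp flip: matrix_mul_assoc)
  then show ?thesis by (simp add: assms)
qed

text \<open>This is how pseudoinverses of the recovered factors act on the true ones. With full
  column rank, \<open>pinv (U ** P)\<close> is a left inverse of \<open>U ** P\<close>; multiplying
  by \<open>transpose P\<close> on the right removes \<open>P\<close>.\<close>

lemma pinv_permuted_columns: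
  fixes U :: "real^'r^'n"
  assumes "permutation_matrix P" and "CARD('r) \<le> rank U"
  shows "pinv (U ** P) ** U = transpose P"
proof -
  note PP = permutation_matrix_mul_transpose[OF assms(1)]
  obtain L where L: "L ** U = mat 1" using assms(2) by (rule full_column_rank_left_inverse)
  have "(transpose P ** L) ** (U ** P) = transpose P ** (L ** U) ** P"
    by (simp only: matrix_mul_assoc)
  also have "\<dots> = mat 1" using PP by (simp add: L matrix_left_right_inverse)
  finally have "pinv (U ** P) ** (U ** P) = mat 1" by (rule pinv_left_inverse)
  then have "pinv (U ** P) ** (U ** (P ** transpose P)) = transpose P"
    by (simp only: matrix_mul_assoc matrix_mul_lid)
  then show ?thesis by (simp add: PP)
qed

section \<open>Slices and composition of multilinear products\<close>

text \<open>The middle matrix is the core contracted with row \<open>k\<close> of \<open>U3\<close>: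
  the true counterpart of the matrix whose determinant step 1 minimizes.\<close>

lemma slice3_multilinear_mult:
  "slice3 (multilinear_mult U1 U2 U3 G) k =
    U1 ** (\<chi> i j. \<Sum>l\<in>UNIV. U3 $ k $ l * G $ i $ j $ l) ** transpose U2"
proof -
  have "(\<Sum>i1\<in>UNIV. \<Sum>i2\<in>UNIV. \<Sum>i3\<in>UNIV.
       U1 $ a $ i1 * U2 $ b $ i2 * U3 $ k $ i3 * G $ i1 $ i2 $ i3) =
    (\<Sum>i2\<in>UNIV. \<Sum>i1\<in>UNIV. \<Sum>i3\<in>UNIV. U1 $ a $ i1 * (U3 $ k $ i3 * G $ i1 $ i2 $ i3) * U2 $ b $ i2)"
    for a b
    by (subst sum.swap) (simp add: mult_ac)
  then show ?thesis
    by (simp add: slice3_def multilinear_mult_def vec_eq_iff matrix_matrix_mult_def transpose_def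
      sum_distrib_left sum_distrib_right)
qed

lemma slice2_multilinear_mult:
  "slice2 (multilinear_mult U1 U2 U3 G) k =
    U1 ** (\<chi> i j. \<Sum>l\<in>UNIV. U2 $ k $ l * G $ i $ l $ j) ** transpose U3"
proof -
  have "(\<Sum>i1\<in>UNIV. \<Sum>i2\<in>UNIV. \<Sum>i3\<in>UNIV.
       U1 $ a $ i1 * U2 $ k $ i2 * U3 $ c $ i3 * G $ i1 $ i2 $ i3) =
    (\<Sum>i3\<in>UNIV. \<Sum>i1\<in>UNIV. \<Sum>i2\<in>UNIV. U1 $ a $ i1 * (U2 $ k $ i2 * G $ i1 $ i2 $ i3) * U3 $ c $ i3)"
    (is "?l = ?r") for a c
  proof -
    have "?l = (\<Sum>i1\<in>UNIV. \<Sum>i3\<in>UNIV. \<Sum>i2\<in>UNIV.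
       U1 $ a $ i1 * U2 $ k $ i2 * U3 $ c $ i3 * G $ i1 $ i2 $ i3)"
      by (intro sum.cong refl sum.swap)
    also have "\<dots> = ?r"
      by (subst sum.swap) (simp add: mult_ac)
    finally show ?thesis .
  qed
  then show ?thesis
    by (simp add: slice2_def multilinear_mult_def vec_eq_iff matrix_matrix_mult_def transpose_def
      sum_distrib_left sum_distrib_right)
qed

lemma multilinear_mult_compose:
  "multilinear_mult A B C (multilinear_mult U V W G) = multilinear_mult (A ** U) (B ** V) (C ** W) G"
proof -
  have "(\<Sum>i1\<in>UNIV. \<Sum>i2\<in>UNIV. \<Sum>i3\<in>UNIV. A $ a $ i1 * B $ b $ i2 * C $ c $ i3 *
      (\<Sum>j1\<in>UNIV. \<Sum>j2\<in>UNIV. \<Sum>j3\<in>UNIV. U $ i1 $ j1 * V $ i2 $ j2 * W $ i3 $ j3 * G $ j1 $ j2 $ j3)) =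
    (\<Sum>j1\<in>UNIV. \<Sum>j2\<in>UNIV. \<Sum>j3\<in>UNIV. (\<Sum>i1\<in>UNIV. A $ a $ i1 * U $ i1 $ j1) *
      (\<Sum>i2\<in>UNIV. B $ b $ i2 * V $ i2 $ j2) * (\<Sum>i3\<in>UNIV. C $ c $ i3 * W $ i3 $ j3) * G $ j1 $ j2 $ j3)"
    (is "?l = ?r") for a b c
  proof -
    \<comment> \<open>Packing the indices into triples lets a single exchange of two sums replace
      the exchange of six.\<close>
    let ?f = "\<lambda>(i1, i2, i3) (j1, j2, j3). A $ a $ i1 * B $ b $ i2 * C $ c $ i3 *
      (U $ i1 $ j1 * V $ i2 $ j2 * W $ i3 $ j3 * G $ j1 $ j2 $ j3)"
    have sum3: "(\<Sum>i\<in>UNIV. f i) = (\<Sum>x\<in>UNIV. \<Sum>y\<in>UNIV. \<Sum>z\<in>UNIV. f (x, y, z))"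
      for f :: "'x::finite \<times> 'y::finite \<times> 'z::finite \<Rightarrow> real"
      by (simp add: sum.cartesian_product split_def flip: UNIV_Times_UNIV)
    have prod3: "(\<Sum>x\<in>UNIV. f x) * (\<Sum>y\<in>UNIV. g y) * (\<Sum>z\<in>UNIV. h z) * d =
        (\<Sum>x\<in>UNIV. \<Sum>y\<in>UNIV. \<Sum>z\<in>UNIV. f x * (g y * (h z * d)))"
      for f :: "'x::finite \<Rightarrow> real" and g :: "'y::finite \<Rightarrow> real" and h :: "'z::finite \<Rightarrow> real" and d
      unfolding mult.assoc by (simp only: sum_distrib_right) (simp only: sum_distrib_left)
    have "?l = (\<Sum>i\<in>UNIV. \<Sum>j\<in>UNIV. ?f i j)"
      by (simp add: sum3 sum_distrib_left)
    also have "\<dots> = (\<Sum>j\<in>UNIV. \<Sum>i\<in>UNIV. ?f i j)"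
      by (rule sum.swap)
    also have "\<dots> = ?r"
      unfolding prod3 by (simp add: sum3 mult_ac)
    finally show ?thesis .
  qed
  then show ?thesis
    by (simp add: multilinear_mult_def matrix_matrix_mult_def vec_eq_iff)
qed

section \<open>Identifiability in the two optimization steps\<close>

lemma step1_optimal_unique:
  fixes U1 V1 :: "real^'r^'n1" and U2 V2 :: "real^'r^'n2"
  assumes M: "M = U1 ** R ** transpose U2" and rank: "rank M = CARD('r)"
    and U: "0 \<le> U1" "0 \<le> U2" "transpose U1 *v vec 1 = vec 1" "transpose U2 *v vec 1 = vec 1"
    and ssc: "sufficiently_scattered U1" "sufficiently_scattered U2"
    and opt: "step1_optimal M (V1, V2, S)"
  obtains P1 P2 where "permutation_matrix P1" "permutation_matrix P2" "V1 = U1 ** P1" "V2 = U2 ** P2"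
proof -
  have S: "M = V1 ** S ** transpose V2" "0 \<le> V1" "0 \<le> V2"
    "transpose V1 *v vec 1 = vec 1" "transpose V2 *v vec 1 = vec 1"
    using opt by (auto simp: step1_optimal_def is_arg_min_def step1_feasible_def)
  have "step1_feasible M (U1, U2, R)" using M U by (simp add: step1_feasible_def)
  then have le: "\<bar>det S\<bar> \<le> \<bar>det R\<bar>"
    using opt unfolding step1_optimal_def is_arg_min_def
    by (metis (no_types, lifting) case_prod_conv not_less)
  obtain B where B: "V2 = U2 ** B"
    by (rule factorization_unique[of "U1 ** R" U2 "V1 ** S" V2]) (use M S rank in auto)
  \<comment> \<open>Transposing moves the left factors to the right, so the same uniqueness lemma
    compares \<open>U1\<close> with \<open>V1\<close>.\<close>
  have Mt: "transpose M = (U2 ** transpose R) ** transpose U1"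
    "transpose M = (V2 ** transpose S) ** transpose V1"
    by (subst M S(1); simp add: matrix_transpose_mul matrix_mul_assoc)+
  obtain A where A: "V1 = U1 ** A" "U2 ** transpose R = V2 ** transpose S ** transpose A"
    by (rule factorization_unique[of "U2 ** transpose R" U1 "V2 ** transpose S" V1])
      (use Mt rank rank_transpose[of M] in auto)
  have "CARD('r) \<le> rank (U2 ** transpose R)"
    using rank_mul_le_left[of "U2 ** transpose R" "transpose U1"]
    unfolding Mt(1)[symmetric] rank_transpose rank .
  then have rR: "CARD('r) \<le> rank U2" "CARD('r) \<le> rank R"
    using rank_mul_le_left[of U2 "transpose R"] rank_mul_le_right[of U2 "transpose R"]
    by (simp_all add: rank_transpose)
  \<comment> \<open>Cancelling \<open>U2\<close> relates the square middle matrices, hence their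
    determinants.\<close>
  obtain L where L: "L ** U2 = mat 1" using rR(1) by (rule full_column_rank_left_inverse)
  have "L ** U2 ** transpose R = L ** U2 ** (B ** transpose S ** transpose A)"
    using arg_cong[OF A(2), of "(**) L"] by (simp only: B matrix_mul_assoc)
  then have "transpose R = B ** transpose S ** transpose A" by (simp add: L)
  then have "det R = det B * det S * det A" by (metis det_mul det_transpose)
  then have detR: "\<bar>det R\<bar> = \<bar>det A\<bar> * \<bar>det B\<bar> * \<bar>det S\<bar>" by (simp add: abs_mult)
  have R0: "det R \<noteq> 0"
    using full_column_rank_left_inverse[OF rR(2)]
    by (metis invertible_det_nz invertible_left_inverse)
  note hA = sufficiently_scattered_change_of_basis[OF ssc(1) U(3), of A]
  note hB = sufficiently_scattered_change_of_basis[OF ssc(2) U(4), of B]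
  have a1: "\<bar>det A\<bar> \<le> 1" and b1: "\<bar>det B\<bar> \<le> 1" using hA hB A B S by auto
  \<comment> \<open>A nonzero \<open>det S\<close> can be cancelled from \<open>le\<close>, so two
    numbers in the unit interval have product at least 1 and both equal 1.\<close>
  have "\<bar>det S\<bar> > 0" using detR R0 by auto
  then have "1 \<le> \<bar>det A\<bar> * \<bar>det B\<bar>" using le detR by (simp add: mult_le_cancel_right1)
  moreover have "\<bar>det A\<bar> * \<bar>det B\<bar> \<le> \<bar>det A\<bar>" "\<bar>det A\<bar> * \<bar>det B\<bar> \<le> \<bar>det B\<bar>"
    using a1 b1 by (simp_all add: mult_left_le mult_left_le_one_le)
  ultimately have "\<bar>det A\<bar> = 1" "\<bar>det B\<bar> = 1" using a1 b1 by linarith+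
  then show ?thesis using that hA(2) hB(2) A(1) B S by auto
qed

lemma step2_optimal_unique:
  fixes U V :: "real^'k^'n" and R S :: "real^'k^'r"
  assumes M: "M = R ** transpose U" and rank: "rank M = CARD('k)"
    and U: "0 \<le> U" "transpose U *v vec 1 = vec 1"
    and ssc: "sufficiently_scattered U"
    and opt: "step2_optimal M (V, S)"
  obtains P where "permutation_matrix P" "V = U ** P"
proof -
  have S: "M = S ** transpose V" "0 \<le> V" "transpose V *v vec 1 = vec 1"
    using opt by (auto simp: step2_optimal_def is_arg_min_def step2_feasible_def)
  have "step2_feasible M (U, R)" using M U by (simp add: step2_feasible_def)
  then have le: "det (transpose S ** S) \<le> det (transpose R ** R)"
    using opt unfolding step2_optimal_def is_arg_min_def
    by (metis (no_types, lifting) case_prod_conv not_less)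
  obtain A where A: "V = U ** A" "R = S ** transpose A"
    by (rule factorization_unique[of R U S V]) (use M S rank in auto)
  have "CARD('k) \<le> rank R" using rank_mul_le_left[of R "transpose U"] M rank by simp
  then obtain L where L: "L ** R = mat 1" by (rule full_column_rank_left_inverse)
  \<comment> \<open>\<open>R\<close> and \<open>S\<close> need not be square, so
    \<open>det A\<close> enters through the Gram matrices and appears squared.\<close>
  have "transpose R ** R = A ** (transpose S ** S) ** transpose A"
    by (simp add: A(2) matrix_transpose_mul matrix_mul_assoc)
  then have detR: "det (transpose R ** R) = (det A)\<^sup>2 * det (transpose S ** S)"
    by (simp add: det_mul power2_eq_square)
  have "det (transpose R ** R) > 0" using L by (rule det_gram_pos)
  then have "0 < det (transpose S ** S)" using detR by (simp add: zero_less_mult_iff)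
  then have "1 \<le> (det A)\<^sup>2" using le detR by (simp add: mult_le_cancel_right1)
  then have "1 \<le> \<bar>det A\<bar>" by (simp add: abs_le_square_iff[of 1, simplified])
  note hA = sufficiently_scattered_change_of_basis[OF ssc U(2), of A]
  show ?thesis using that hA A S \<open>1 \<le> \<bar>det A\<bar>\<close> by force
qed

section \<open>Recovery of all three factors and of the core\<close>

theorem theorem5p11:
  fixes T :: "real^'n3^'n2^'n1"
    and U1 V1 :: "real^'r^'n1" and U2 V2 :: "real^'r^'n2" and U3 V3 :: "real^'r3^'n3"
    and G K :: "real^'r3^'r^'r"
    and i2 :: 'n2 and i3 :: 'n3
  assumes "T = multilinear_mult U1 U2 U3 G"
    and "0 \<le> U1" "0 \<le> U2" "0 \<le> U3"
    and "transpose U1 *v vec 1 = vec 1" "transpose U2 *v vec 1 = vec 1" "transpose U3 *v vec 1 = vec 1"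
    and "CARD('r3) \<le> CARD('r)"
    and "sufficiently_scattered U1" "sufficiently_scattered U2" "sufficiently_scattered U3"
    and "rank (slice3 T i3) = CARD('r)"
    and "rank (slice2 T i2) = CARD('r3)"
    and "procedure_output T i2 i3 V1 V2 V3 K"
  shows "\<exists>P1 P2 P3. permutation_matrix P1 \<and> permutation_matrix P2 \<and> permutation_matrix P3 \<and>
    V1 = U1 ** P1 \<and> V2 = U2 ** P2 \<and> V3 = U3 ** P3 \<and>
    K = multilinear_mult (transpose P1) (transpose P2) (transpose P3) G"
proof -
  note T = assms(1)
  define R where "R = (\<chi> i j. \<Sum>l\<in>UNIV. U3 $ i3 $ l * G $ i $ j $ l)"
  define Q where "Q = (\<chi> i j. \<Sum>l\<in>UNIV. U2 $ i2 $ l * G $ i $ l $ j)"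
  have s3: "slice3 T i3 = U1 ** R ** transpose U2"
    by (simp add: T R_def slice3_multilinear_mult)
  have s2: "slice2 T i2 = U1 ** Q ** transpose U3"
    by (simp add: T Q_def slice2_multilinear_mult)
  obtain S S' where opt: "step1_optimal (slice3 T i3) (V1, V2, S)"
      "step2_optimal (pinv V1 ** slice2 T i2) (V3, S')"
    and K: "K = multilinear_mult (pinv V1) (pinv V2) (pinv V3) T"
    using assms(14) by (auto simp: procedure_output_def)
  obtain P1 P2 where P: "permutation_matrix P1" "permutation_matrix P2"
      "V1 = U1 ** P1" "V2 = U2 ** P2"
    using step1_optimal_unique[OF s3 assms(12,2,3,5,6,9,10) opt(1)] by blast
  have r1: "CARD('r) \<le> rank U1"
    using rank_mul_le_left[of U1 "R ** transpose U2"] s3 assms(12) by (simp add: matrix_mul_assoc)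
  have r2: "CARD('r) \<le> rank U2"
    using rank_mul_le_right[of "U1 ** R" "transpose U2"] s3 assms(12) by (simp add: rank_transpose)
  have r3: "CARD('r3) \<le> rank U3"
    using rank_mul_le_right[of "U1 ** Q" "transpose U3"] s2 assms(13) by (simp add: rank_transpose)
  have inv1: "pinv V1 ** U1 = transpose P1"
    using pinv_permuted_columns[OF P(1) r1] P(3) by simp
  \<comment> \<open>The permutation found in step 1 only reorders the rows of \<open>Q\<close>, so
    the data of step 2 still factor through \<open>U3\<close>.\<close>
  have M: "pinv V1 ** slice2 T i2 = (transpose P1 ** Q) ** transpose U3"
    by (simp add: s2 matrix_mul_assoc inv1)
  \<comment> \<open>Multiplying back by \<open>V1\<close> restores the slice, so applying
    \<open>pinv V1\<close> loses no rank.\<close>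
  have "V1 ** (pinv V1 ** slice2 T i2) = U1 ** (P1 ** transpose P1) ** Q ** transpose U3"
    by (subst M) (simp only: P(3) matrix_mul_assoc)
  also have "\<dots> = slice2 T i2"
    by (simp add: s2 permutation_matrix_mul_transpose[OF P(1)])
  finally have "rank (pinv V1 ** slice2 T i2) = CARD('r3)"
    using rank_mul_le_right[of V1 "pinv V1 ** slice2 T i2"]
      rank_mul_le_right[of "pinv V1" "slice2 T i2"] assms(13) by simp
  then obtain P3 where P3: "permutation_matrix P3" "V3 = U3 ** P3"
    using step2_optimal_unique[OF M _ assms(4,7,11) opt(2)] by blast
  \<comment> \<open>By composition, mode \<open>i\<close> of the core is multiplied by the
    pseudoinverse of the recovered factor times the true one, which is the transposed
    permutation.\<close>
  have "K = multilinear_mult (transpose P1) (transpose P2) (transpose P3) G"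
    using pinv_permuted_columns[OF P(2) r2] pinv_permuted_columns[OF P3(1) r3] P(4) P3(2)
    by (simp add: K T multilinear_mult_compose inv1)
  then show ?thesis using P P3 by blast
qed

end
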